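(* Let $n\ge 1$ be an integer, $B>0$, $p\ge 1$, and let $f:[0,\infty)\to[0,\infty)$ be continuous with $f(0)=0$. Put $g_p(x)=f(x)^p$ for $x\ge 0$ and $r(x)=f(x)^p/x$ for $x>0$. Suppose that $r$ attains its supremum over $(0,B]$ at a unique point $x^*$, and that $k^*:=B/x^*$ is an integer with $1\le k^*\le n$. Then every maximizer of $\sum_{i=1}^n g_p(x_i)$ over $\mathbf{x}\in\mathcal{B}_B$ is a balanced allocation of order $k^*$; that is, exactly $k^*$ coordinates equal $B/k^*$ and the rest vanish. Moreover the maximum value is $$\max_{\mathbf{x}\in\mathcal{B}_B}\sum_{i=1}^n g_p(x_i)=B\,r(x^* )=k^*\,g_p\!\left(\frac{B}{k^*}\right).$$
   Context: For $B>0$, $\mathcal{B}_B=\{\mathbf{x}\in[0,\infty)^n:\sum_{i=1}^n x_i=B\}$. For an integer $k$ with $1\le k\le n$, a balanced allocation of order $k$ is a vector in $\mathcal{B}_B$ in which $k$ coordinates equal $B/k$ and the other $n-k$ coordinates equal $0$. *)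

theory Defs
  imports "HOL-Analysis.Analysis"
begin

text \<open>Vectors are indexed by a finite type \<open>'n\<close>, so the dimension \<open>n\<close> is \<open>CARD('n)\<close>.\<close>

definition allocations :: "real \<Rightarrow> (real ^ 'n) set" where
  "allocations B = {x. (\<forall>i. 0 \<le> x $ i) \<and> (\<Sum>i\<in>UNIV. x $ i) = B}"

definition balanced_allocation :: "real \<Rightarrow> nat \<Rightarrow> real ^ 'n \<Rightarrow> bool" where
  "balanced_allocation B k x \<longleftrightarrow>
     1 \<le> k \<and> k \<le> CARD('n) \<and> x \<in> allocations B \<and>
     card {i. x $ i = B / real k} = k \<and>
     (\<forall>i. x $ i \<noteq> B / real k \<longrightarrow> x $ i = 0)"

text \<open>The exponent \<open>p\<close> is real; \<open>powr\<close> is the usual power at nonnegative bases,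
  since \<open>0 powr p = 0\<close> and \<open>p \<ge> 1\<close>.\<close>

definition g_pow :: "(real \<Rightarrow> real) \<Rightarrow> real \<Rightarrow> real \<Rightarrow> real" where
  "g_pow f p x = f x powr p"

text \<open>Only meant for \<open>x > 0\<close>.\<close>

definition r_ratio :: "(real \<Rightarrow> real) \<Rightarrow> real \<Rightarrow> real \<Rightarrow> real" where
  "r_ratio f p x = f x powr p / x"

definition objective :: "(real \<Rightarrow> real) \<Rightarrow> real \<Rightarrow> real ^ 'n \<Rightarrow> real" where
  "objective f p x = (\<Sum>i\<in>UNIV. g_pow f p (x $ i))"

text \<open>Unlike \<open>Sup\<close> or \<open>GREATEST\<close>, this includes that the maximum is attained.\<close>

definition is_maximum :: "real set \<Rightarrow> real \<Rightarrow> bool" where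
  "is_maximum A v \<longleftrightarrow> v \<in> A \<and> (\<forall>w\<in>A. w \<le> v)"

end

theory Submission
  imports Defs
begin

text \<open>Write \<open>x\<^sup>*\<close> for the maximizer of the ratio \<open>r\<close>. On \<open>[0, B]\<close> the function \<open>g\<^sub>p\<close> lies below the
  line \<open>y \<mapsto> r(x\<^sup>*) y\<close> and touches it only at \<open>0\<close> and \<open>x\<^sup>*\<close>. Summing over the coordinates bounds
  the objective by \<open>B r(x\<^sup>*)\<close>, with equality exactly when every coordinate is \<open>0\<close> or \<open>x\<^sup>*\<close>; the
  budget constraint then forces \<open>B / x\<^sup>*\<close> coordinates to equal \<open>x\<^sup>*\<close>.\<close>

text \<open>Uniqueness gives strictness: since \<open>y\<close> is not a maximizer, some admissible
  \<open>z\<close> beats it, and \<open>a\<close> is at least as good as \<open>z\<close>.\<close>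

lemma unique_arg_max_less:
  fixes f :: "'a \<Rightarrow> 'b::linorder"
  assumes "{x. is_arg_max f P x} = {a}" "P y" "y \<noteq> a"
  shows "f y < f a"
proof -
  have a: "is_arg_max f P a" and y: "\<not> is_arg_max f P y"
    using assms by blast+
  from y \<open>P y\<close> obtain z where "P z" "f y < f z"
    by (auto simp: is_arg_max_def)
  moreover from a \<open>P z\<close> have "f z \<le> f a"
    by (auto simp: is_arg_max_linorder)
  ultimately show ?thesis by order
qed

lemma allocations_component_le:
  assumes "x \<in> allocations B"
  shows "x $ i \<le> B"
  using assms member_le_sum[of i UNIV "\<lambda>i. x $ i"] by (auto simp: allocations_def)

lemma sum_two_valued:
  fixes x :: "real ^ 'n"
  assumes "\<And>i. x $ i = 0 \<or> x $ i = c"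
  shows "(\<Sum>i\<in>UNIV. x $ i) = real (card {i. x $ i = c}) * c"
proof -
  have "(\<Sum>i\<in>UNIV. x $ i) = (\<Sum>i\<in>{i. x $ i = c}. x $ i)"
    by (rule sum.mono_neutral_right) (use assms in auto)
  then show ?thesis by simp
qed

text \<open>The budget fixes the count: \<open>c\<close> coordinates equal to \<open>B / k\<close>
  sum to \<open>c * (B / k) = B\<close>, and cancelling \<open>B > 0\<close> leaves
  \<open>c = k\<close>.\<close>

lemma allocation_two_valued_balanced:
  fixes x :: "real ^ 'n"
  assumes "B > 0" "1 \<le> k" "k \<le> CARD('n)" "x \<in> allocations B"
    and "\<And>i. x $ i = 0 \<or> x $ i = B / real k"
  shows "balanced_allocation B k x"
proof -
  have "real (card {i. x $ i = B / real k}) * (B / real k) = B"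
    using sum_two_valued[OF assms(5)] assms(4) by (simp add: allocations_def)
  then have "card {i. x $ i = B / real k} = k"
    using assms(1,2) by (simp add: field_simps)
  with assms show ?thesis
    by (auto simp: balanced_allocation_def)
qed

lemma balanced_allocation_exists:
  assumes "B > 0" "1 \<le> k" "k \<le> CARD('n)"
  obtains x :: "real ^ 'n" where "balanced_allocation B k x"
proof -
  obtain S :: "'n set" where S: "card S = k"
    using obtain_subset_with_card_n[OF assms(3)] by blast
  define x :: "real ^ 'n" where "x = (\<chi> i. if i \<in> S then B / real k else 0)"
  have "(\<Sum>i\<in>UNIV. x $ i) = (\<Sum>i\<in>S. B / real k)"
    unfolding x_def by (simp add: sum.If_cases)
  then have "x \<in> allocations B"
    using assms S by (auto simp: allocations_def x_def)
  then have "balanced_allocation B k x"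
    using assms by (intro allocation_two_valued_balanced) (auto simp: x_def)
  then show thesis by (rule that)
qed

lemma objective_balanced:
  assumes "f 0 = 0" "balanced_allocation B k x"
  shows "objective f p x = real k * g_pow f p (B / real k)"
proof -
  have "objective f p x = (\<Sum>i\<in>{i. x $ i = B / real k}. g_pow f p (x $ i))"
    unfolding objective_def
    by (rule sum.mono_neutral_right) (use assms in \<open>auto simp: balanced_allocation_def g_pow_def\<close>)
  then show ?thesis
    using assms by (simp add: balanced_allocation_def)
qed

text \<open>The linear bound has the same total \<open>B * m\<close> on every allocation. Equality
  of the two sums forces equality in each coordinate, because every term obeys the bound.\<close>

lemma objective_le_chord:
  assumes "x \<in> allocations B" "\<And>y. 0 \<le> y \<Longrightarrow> y \<le> B \<Longrightarrow> g_pow f p y \<le> m * y"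
  shows "objective f p x \<le> B * m"
    and "objective f p x = B * m \<Longrightarrow> g_pow f p (x $ i) = m * x $ i"
proof -
  have le: "g_pow f p (x $ i) \<le> m * x $ i" for i
    using assms allocations_component_le[of x B i] by (auto simp: allocations_def)
  have total: "(\<Sum>i\<in>UNIV. m * x $ i) = B * m"
    using assms(1) by (simp add: allocations_def flip: sum_distrib_left)
  show "objective f p x \<le> B * m"
    unfolding objective_def total[symmetric] by (intro sum_mono le)
  show "g_pow f p (x $ i) = m * x $ i" if "objective f p x = B * m"
    using that le sum_mono_inv[of "\<lambda>i. g_pow f p (x $ i)" UNIV "\<lambda>i. m * x $ i" i]
    unfolding objective_def total[symmetric] by auto
qed

theorem theorem5p4:
  fixes f :: "real \<Rightarrow> real" and B p xstar :: real and kstar :: nat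
  assumes "B > 0" and "p \<ge> 1"
    and "f \<in> {0..} \<rightarrow> {0..}" and "continuous_on {0..} f" and "f 0 = 0"
    and "{x. is_arg_max (r_ratio f p) (\<lambda>x. x \<in> {0<..B}) x} = {xstar}"
    and "real kstar = B / xstar" and "1 \<le> kstar" and "kstar \<le> CARD('n)"
  shows "(\<forall>x :: real ^ 'n. is_arg_max (objective f p) (\<lambda>x. x \<in> allocations B) x
            \<longrightarrow> balanced_allocation B kstar x)
       \<and> is_maximum (objective f p ` (allocations B :: (real ^ 'n) set)) (B * r_ratio f p xstar)
       \<and> B * r_ratio f p xstar = real kstar * g_pow f p (B / real kstar)"
proof -
  define m where "m = r_ratio f p xstar"
  have "is_arg_max (r_ratio f p) (\<lambda>x. x \<in> {0<..B}) xstar"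
    using assms(6) by blast
  then have "xstar > 0"
    by (simp add: is_arg_max_def)
  then have xstar: "B / real kstar = xstar"
    using assms(1,7) by simp
  have strict: "g_pow f p y < m * y" if "0 < y" "y \<le> B" "y \<noteq> xstar" for y
    using unique_arg_max_less[OF assms(6), of y] that
    by (simp add: m_def r_ratio_def g_pow_def pos_divide_less_eq)
  have touch: "g_pow f p xstar = m * xstar"
    using \<open>xstar > 0\<close> by (simp add: m_def r_ratio_def g_pow_def)
  \<comment> \<open>The ratio controls only positive arguments, so \<open>y = 0\<close> is separate:
    there both sides vanish because \<open>f 0 = 0\<close>.\<close>
  have chord: "g_pow f p y \<le> m * y" if "0 \<le> y" "y \<le> B" for y
    using strict[of y] touch that assms(5) by (cases "y = 0 \<or> y = xstar") (auto simp: g_pow_def)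
  have max_value: "B * m = real kstar * g_pow f p (B / real kstar)"
    unfolding xstar touch using assms(7) \<open>xstar > 0\<close> by simp
  \<comment> \<open>The witness \<open>z\<close> serves twice: it shows that the bound
    \<open>B * m\<close> is attained, and it forces every maximizer to reach that value.\<close>
  obtain z :: "real ^ 'n" where z: "balanced_allocation B kstar z"
    using balanced_allocation_exists assms(1,8,9) by blast
  then have z_alloc: "z \<in> allocations B"
    by (simp add: balanced_allocation_def)
  have z_value: "objective f p z = B * m"
    using objective_balanced[of f, OF assms(5) z] max_value by simp
  have "balanced_allocation B kstar x"
    if x: "is_arg_max (objective f p) (\<lambda>x. x \<in> allocations B) x" for x :: "real ^ 'n"
  proof -
    have x_alloc: "x \<in> allocations B" and "B * m \<le> objective f p x"
      using x z_alloc z_value by (auto simp: is_arg_max_linorder)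
    then have eq: "g_pow f p (x $ i) = m * x $ i" for i
      using objective_le_chord[OF x_alloc chord] by (simp add: order_antisym)
    \<comment> \<open>Any other coordinate would lie in \<open>{0<..B}\<close> away from
      \<open>xstar\<close>, where \<open>strict\<close> excludes the equality
      \<open>eq\<close>.\<close>
    have "x $ i = 0 \<or> x $ i = B / real kstar" for i
      using strict[of "x $ i"] eq[of i] x_alloc allocations_component_le[OF x_alloc, of i]
      by (force simp: xstar allocations_def order_less_le)
    with assms(1,8,9) x_alloc show ?thesis
      by (intro allocation_two_valued_balanced)
  qed
  moreover have "is_maximum (objective f p ` (allocations B :: (real ^ 'n) set)) (B * m)"
  proof -
    have "objective f p w \<le> B * m" if "w \<in> allocations B" for w :: "real ^ 'n"
      using that chord by (rule objective_le_chord(1))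
    then show ?thesis
      using z_alloc by (auto simp: is_maximum_def simp flip: z_value)
  qed
  ultimately show ?thesis
    using max_value by (simp add: m_def)
qed

end
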